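(* For any $\lambda>0$ the vacuum distribution of $P_1(\lambda)=a_1+a_1^{\dagger}+\lambda a_1^{\dagger}a_1$ is the two-points law $$ \rho=\left(\frac{1}{2}-\frac{\lambda}{2\sqrt{\lambda^2+4}}\right)\delta_{\frac{\lambda+\sqrt{\lambda^2+4}}{2}} + \left(\frac{1}{2}+\frac{\lambda}{2\sqrt{\lambda^2+4}}\right)\delta_{\frac{\lambda-\sqrt{\lambda^2+4}}{2}}. $$
   Context: Let $\mathcal{H}$ be a separable Hilbert space with a fixed orthonormal basis $(e_i)_{i\ge1}$. The monotone Fock space over $\mathcal{H}$ is the closed subspace of the full Fock space on $\mathcal{H}$ (with vacuum vector $\Omega=1\oplus0\oplus\cdots$) spanned by $\Omega$, $\mathcal{H}$ and all simple tensors $e_{i_1}\otimes e_{i_2}\otimes\cdots\otimes e_{i_k}$ with $i_1>i_2>\cdots>i_k$, $k\ge2$; write $e_{(i_1,\ldots,i_k)}$ for this tensor (and $e_{(i)}=e_i$). The monotone creation and annihilation operators $a_i^{\dagger}$, $a_i$ ($i\ge1$) are the mutually adjoint bounded operators on it determined by $a_i^{\dagger}\Omega=e_i$, $a_i\Omega=0$; $a_i^{\dagger}e_{(i_1,\ldots,i_k)}=e_{(i,i_1,\ldots,i_k)}$ if $i>i_1$ and $0$ otherwise; $a_ie_{(i_1,\ldots,i_k)}=e_{(i_2,\ldots,i_k)}$ if $i=i_1$ (this being $\Omega$ when $k=1$) and $0$ otherwise. The vacuum distribution of a bounded selfadjoint operator $T$ is the unique probability measure $\mu$ on $\mathbb{R}$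 with $\int x^n\,\mu(dx)=\langle T^n\Omega,\Omega\rangle$ for all $n\ge0$. $\delta_x$ is the Dirac measure at $x$. *)

theory Defs
  imports "HOL-Probability.Probability"
begin

text \<open>
  The library has only real inner products. The real structure (norm, topology, completeness)
  is taken from it; the norm is the one of the complex inner product by \<open>inner_eq_Re_cinner\<close>.
\<close>

class complex_hilbert_space = real_inner + complete_space +
  fixes scaleC :: "complex \<Rightarrow> 'a \<Rightarrow> 'a"  (infixr "*\<^sub>C" 75)
    and cinner :: "'a \<Rightarrow> 'a \<Rightarrow> complex"
  assumes scaleR_scaleC: "scaleR r x = complex_of_real r *\<^sub>C x"
    and scaleC_add_right: "c *\<^sub>C (x + y) = c *\<^sub>C x + c *\<^sub>C y"
    and scaleC_add_left: "(c + d) *\<^sub>C x = c *\<^sub>C x + d *\<^sub>C x"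
    and scaleC_scaleC: "c *\<^sub>C d *\<^sub>C x = (c * d) *\<^sub>C x"
    and cinner_commute: "cinner x y = cnj (cinner y x)"
    and cinner_add_left: "cinner (x + y) z = cinner x z + cinner y z"
    and cinner_scaleC_left: "cinner (c *\<^sub>C x) y = c * cinner x y"
    and inner_eq_Re_cinner: "inner x y = Re (cinner x y)"

lemma scaleC_one: "1 *\<^sub>C x = (x :: 'a::complex_hilbert_space)"
  using scaleR_scaleC[of 1 x] by simp

lemma cinner_self: "cinner x x = complex_of_real ((norm (x :: 'a::complex_hilbert_space))\<^sup>2)"
proof -
  have "Im (cinner x x) = 0"
    using arg_cong[OF cinner_commute[of x x], of Im] by simp
  moreover have "Re (cinner x x) = (norm x)\<^sup>2"
    using inner_eq_Re_cinner[of x x] by (simp add: power2_norm_eq_inner)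
  ultimately show ?thesis
    by (simp add: complex_eq_iff)
qed


global_interpretation complex_vs:
  vector_space "scaleC :: complex \<Rightarrow> 'a \<Rightarrow> 'a::complex_hilbert_space"
  by unfold_locales
    (auto simp: scaleC_add_right scaleC_add_left scaleC_scaleC scaleC_one)

definition closed_cspan :: "'a::complex_hilbert_space set \<Rightarrow> 'a set" where
  "closed_cspan S = closure (module.span scaleC S)"

definition orthonormal_basis_on :: "'i set \<Rightarrow> ('i \<Rightarrow> 'a::complex_hilbert_space) \<Rightarrow> bool" where
  "orthonormal_basis_on I e \<longleftrightarrow>
     (\<forall>i\<in>I. \<forall>j\<in>I. cinner (e i) (e j) = (if i = j then 1 else 0)) \<and>
     closed_cspan (e ` I) = UNIV"

text \<open>
  The full Fock space over \<open>'h\<close>, up to its unique unitary isomorphism: a Hilbert space \<open>'f\<close> with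
  the map sending a list \<open>[x1, \<dots>, xn]\<close> to the simple tensor \<open>x1 \<otimes> \<dots> \<otimes> xn\<close>, the empty list
  giving the vacuum vector. The inner products of simple tensors are those of the Hilbert space
  tensor powers (multilinearity of the map follows from them), tensors of different lengths are
  orthogonal, and the simple tensors are total.
\<close>

definition full_fock_space ::
  "('h::complex_hilbert_space list \<Rightarrow> 'f::complex_hilbert_space) \<Rightarrow> bool" where
  "full_fock_space tensor \<longleftrightarrow>
     (\<forall>xs ys. cinner (tensor xs) (tensor ys) =
        (if length xs = length ys then \<Prod>k<length xs. cinner (xs ! k) (ys ! k) else 0)) \<and>
     closed_cspan (range tensor) = UNIV"

text \<open>Words \<open>i1 > \<dots> > ik \<ge> 1\<close>; the empty word is included and labels the vacuum.\<close>

definition decreasing_word :: "nat list \<Rightarrow> bool" where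
  "decreasing_word w \<longleftrightarrow> sorted_wrt (>) w \<and> (\<forall>i\<in>set w. 1 \<le> i)"

definition basis_tensor :: "('h list \<Rightarrow> 'f) \<Rightarrow> (nat \<Rightarrow> 'h) \<Rightarrow> nat list \<Rightarrow> 'f" where
  "basis_tensor tensor e w = tensor (map e w)"

definition monotone_fock_space ::
  "('h::complex_hilbert_space list \<Rightarrow> 'f::complex_hilbert_space) \<Rightarrow> (nat \<Rightarrow> 'h) \<Rightarrow> 'f set" where
  "monotone_fock_space tensor e = closed_cspan
     ({tensor []} \<union> range (\<lambda>x. tensor [x]) \<union>
      {basis_tensor tensor e w | w. 2 \<le> length w \<and> decreasing_word w})"

definition bounded_operator_on :: "'a::complex_hilbert_space set \<Rightarrow> ('a \<Rightarrow> 'a) \<Rightarrow> bool" where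
  "bounded_operator_on M T \<longleftrightarrow>
     T ` M \<subseteq> M \<and>
     (\<forall>x\<in>M. \<forall>y\<in>M. T (x + y) = T x + T y) \<and>
     (\<forall>c. \<forall>x\<in>M. T (c *\<^sub>C x) = c *\<^sub>C T x) \<and>
     (\<exists>K. \<forall>x\<in>M. norm (T x) \<le> K * norm x)"

definition adjoint_on ::
  "'a::complex_hilbert_space set \<Rightarrow> ('a \<Rightarrow> 'a) \<Rightarrow> ('a \<Rightarrow> 'a) \<Rightarrow> bool" where
  "adjoint_on M S T \<longleftrightarrow> (\<forall>x\<in>M. \<forall>y\<in>M. cinner (S x) y = cinner x (T y))"

text \<open>
  The defining properties of the annihilators \<open>a i\<close> and creators \<open>ad i\<close>. The functions are defined
  on all of \<open>'f\<close>, but they are constrained only on the monotone Fock space and for \<open>i \<ge> 1\<close>.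
\<close>

definition monotone_annihilation_creation ::
  "('h::complex_hilbert_space list \<Rightarrow> 'f::complex_hilbert_space) \<Rightarrow> (nat \<Rightarrow> 'h) \<Rightarrow>
   (nat \<Rightarrow> 'f \<Rightarrow> 'f) \<Rightarrow> (nat \<Rightarrow> 'f \<Rightarrow> 'f) \<Rightarrow> bool" where
  "monotone_annihilation_creation tensor e a ad \<longleftrightarrow>
     (\<forall>i\<ge>1.
        bounded_operator_on (monotone_fock_space tensor e) (a i) \<and>
        bounded_operator_on (monotone_fock_space tensor e) (ad i) \<and>
        adjoint_on (monotone_fock_space tensor e) (ad i) (a i) \<and>
        ad i (tensor []) = tensor [e i] \<and>
        a i (tensor []) = 0 \<and>
        (\<forall>w. w \<noteq> [] \<and> decreasing_word w \<longrightarrow>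
           ad i (basis_tensor tensor e w) =
             (if i > hd w then basis_tensor tensor e (i # w) else 0) \<and>
           a i (basis_tensor tensor e w) =
             (if i = hd w then basis_tensor tensor e (tl w) else 0)))"

definition has_vacuum_moments ::
  "'a::complex_hilbert_space \<Rightarrow> ('a \<Rightarrow> 'a) \<Rightarrow> real measure \<Rightarrow> bool" where
  "has_vacuum_moments \<Omega> T \<mu> \<longleftrightarrow>
     prob_space \<mu> \<and> sets \<mu> = sets borel \<and>
     (\<forall>n. integrable \<mu> (\<lambda>x. x ^ n) \<and>
          complex_of_real (\<integral>x. x ^ n \<partial>\<mu>) = cinner ((T ^^ n) \<Omega>) \<Omega>)"

definition is_vacuum_distribution ::
  "'a::complex_hilbert_space set \<Rightarrow> 'a \<Rightarrow> ('a \<Rightarrow> 'a) \<Rightarrow> real measure \<Rightarrow> bool" where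
  "is_vacuum_distribution M \<Omega> T \<mu> \<longleftrightarrow>
     bounded_operator_on M T \<and> adjoint_on M T T \<and>
     has_vacuum_moments \<Omega> T \<mu> \<and> (\<forall>\<nu>. has_vacuum_moments \<Omega> T \<nu> \<longrightarrow> \<nu> = \<mu>)"

text \<open>The measure \<open>p \<delta>_x + q \<delta>_y\<close>, for \<open>p, q \<ge> 0\<close> (a negative weight would be truncated to 0).\<close>

definition two_point_measure :: "real \<Rightarrow> real \<Rightarrow> real \<Rightarrow> real \<Rightarrow> real measure" where
  "two_point_measure p x q y = measure_of UNIV (sets borel)
     (\<lambda>A. ennreal p * emeasure (return borel x) A + ennreal q * emeasure (return borel y) A)"

lemma sets_two_point_measure [simp]: "sets (two_point_measure p x q y) = sets borel"
  unfolding two_point_measure_def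
  using sigma_algebra.sets_measure_of_eq[OF sets.sigma_algebra_axioms[of "borel :: real measure"]]
  by simp

lemma emeasure_two_point_measure:
  assumes "A \<in> sets borel"
  shows "emeasure (two_point_measure p x q y) A =
    ennreal p * emeasure (return borel x) A + ennreal q * emeasure (return borel y) A"
    (is "_ = ?f A")
proof (rule emeasure_measure_of[OF two_point_measure_def])
  show "countably_additive (sets (two_point_measure p x q y)) ?f"
  proof (rule countably_additiveI)
    fix B :: "nat \<Rightarrow> real set"
    assume B: "range B \<subseteq> sets (two_point_measure p x q y)" "disjoint_family B"
    have *: "(\<Sum>i. emeasure (return borel z) (B i)) = emeasure (return borel z) (\<Union>i. B i)" for z
      using B by (intro suminf_emeasure) auto
    show "(\<Sum>i. ?f (B i)) = ?f (\<Union>i. B i)"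
      by (simp add: suminf_add[symmetric] ennreal_suminf_cmult *)
  qed
qed (use assms in \<open>auto simp: positive_def\<close>)

end

theory Submission
  imports Defs
begin

text \<open>
  The vacuum \<open>\<Omega>\<close> and \<open>e\<^sub>1\<close> span a plane that \<open>P\<^sub>1(\<lambda>)\<close> maps to itself: \<open>P\<^sub>1(\<lambda>) \<Omega> = e\<^sub>1\<close> and
  \<open>P\<^sub>1(\<lambda>) e\<^sub>1 = \<Omega> + \<lambda> e\<^sub>1\<close>, because \<open>a\<^sub>1\<close> annihilates \<open>\<Omega>\<close> and no
  decreasing word contains the letter 1 twice, so that \<open>a\<^sub>1\<^sup>\<dagger> e\<^sub>1 = 0\<close>. On this plane
  \<open>P\<^sub>1(\<lambda>)\<close> has the characteristic polynomial \<open>t\<^sup>2 - \<lambda> t - 1\<close>, whose roots \<open>x > y\<close> are the two atoms.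
  Let \<open>p\<close>, \<open>q\<close> be the weights of \<open>x\<close>, \<open>y\<close> and put \<open>m n = p x\<^sup>n + q y\<^sup>n\<close>. Then \<open>m 0 = 1\<close>, \<open>m 1 = 0\<close>
  and \<open>m (n+2) = \<lambda> m (n+1) + m n\<close>, and induction gives
  \<open>P\<^sub>1(\<lambda>)\<^sup>n \<Omega> = m n \<Omega> + m (n+1) e\<^sub>1\<close> (lemma \<open>vacuum_plane_power\<close>). As \<open>\<Omega>\<close> and \<open>e\<^sub>1\<close> are orthonormal,
  the vacuum moments are the numbers \<open>m n\<close>, the moments of the two-point law.

  Uniqueness of the law needs no general moment theory (lemma \<open>two_point_measure_determined\<close>): the
  first four moments give \<open>\<integral> (t - x)\<^sup>2 (t - y)\<^sup>2 d\<nu> = 0\<close>, so \<open>\<nu>\<close> lives on \<open>{x, y}\<close>, and there every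
  function agrees with an affine one, whose integral is a combination of the moments 0 and 1.
\<close>

section \<open>Two-point measures and their moments\<close>

lemma AE_two_point_measure: "AE z in two_point_measure p x q y. z \<in> {x, y}"
proof (rule AE_I')
  show "- {x, y} \<in> null_sets (two_point_measure p x q y)"
    by (intro null_setsI) (auto simp: emeasure_two_point_measure)
qed (auto simp: two_point_measure_def)

lemma prob_space_two_point_measure:
  assumes "p \<ge> 0" "q \<ge> 0" "p + q = 1"
  shows "prob_space (two_point_measure p x q y)"
proof (rule prob_spaceI)
  have "space (two_point_measure p x q y) = UNIV"
    using sets_eq_imp_space_eq[OF sets_two_point_measure] by simp
  then show "emeasure (two_point_measure p x q y) (space (two_point_measure p x q y)) = 1"
    using assms by (simp add: emeasure_two_point_measure ennreal_plus[symmetric] del: ennreal_plus)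
qed

lemma has_bochner_integral_two_point_measure:
  assumes "p \<ge> 0" "q \<ge> 0" "x \<noteq> y" and f: "f \<in> borel_measurable borel"
  shows "has_bochner_integral (two_point_measure p x q y) f (p * f x + q * f y :: real)"
proof -
  let ?M = "two_point_measure p x q y"
  have atom: "has_bochner_integral ?M (indicator {z} :: real \<Rightarrow> real) (measure ?M {z})" for z
    by (rule has_bochner_integral_real_indicator)
      (auto simp: emeasure_two_point_measure ennreal_mult_less_top indicator_def)
  have m: "measure ?M {x} = p" "measure ?M {y} = q"
    using assms by (auto simp: measure_def emeasure_two_point_measure indicator_def)
  have "has_bochner_integral ?M
      (\<lambda>z. f x * indicator {x} z + f y * indicator {y} z) (f x * p + f y * q)"
    using atom[of x] atom[of y] unfolding m
    by (intro has_bochner_integral_add has_bochner_integral_mult_right) auto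
  moreover have "AE z in ?M. f z = f x * indicator {x} z + f y * indicator {y} z"
    using AE_two_point_measure[where p = p and x = x and q = q and y = y] by eventually_elim (use assms in auto)
  moreover have "f \<in> borel_measurable ?M"
    using f by (simp add: measurable_cong_sets[OF sets_two_point_measure refl])
  ultimately show ?thesis
    by (subst has_bochner_integral_cong_AE
        [where g = "\<lambda>z. f x * indicator {x} z + f y * indicator {y} z"])
      (auto simp: measurable_cong_sets[OF sets_two_point_measure refl] mult.commute)
qed

text \<open>
  The quartic \<open>(t - x)\<^sup>2 (t - y)\<^sup>2\<close> is nonnegative and vanishes exactly at the atoms, so four moments
  suffice to locate the support. On \<open>{x, y}\<close> the indicator of a set is replaced by its linear
  interpolation, which turns its integral into moments.
\<close>

lemma two_point_measure_determined:
  fixes \<nu> :: "real measure"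
  assumes "prob_space \<nu>" and sets: "sets \<nu> = sets borel"
    and int: "\<And>n. integrable \<nu> (\<lambda>z. z ^ n)"
    and mom: "\<And>n. n \<le> 4 \<Longrightarrow> (\<integral>z. z ^ n \<partial>\<nu>) = p * x ^ n + q * y ^ n"
    and "p \<ge> 0" "q \<ge> 0" "x \<noteq> y"
  shows "\<nu> = two_point_measure p x q y"
proof (rule measure_eqI)
  interpret prob_space \<nu> by fact
  have int1: "integrable \<nu> (\<lambda>z. z)" and mom1: "(\<integral>z. z \<partial>\<nu>) = p * x + q * y"
    using int[of 1] mom[of 1] by auto
  have pq: "p + q = 1" using mom[of 0] by (simp add: prob_space)
  define s d where "s = x + y" and "d = x * y"
  let ?Q = "\<lambda>z. ((z - x) * (z - y))\<^sup>2"
  \<comment> \<open>The exponents 1 and 0 are kept so that every term is a moment after integration.\<close>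
  let ?P = "\<lambda>z. z ^ 4 - 2 * s * z ^ 3 + (s\<^sup>2 + 2 * d) * z ^ 2 - 2 * s * d * z ^ 1 + d\<^sup>2 * z ^ 0"
  have Q: "?Q = ?P"
    by (rule ext) (simp add: s_def d_def power2_eq_square power3_eq_cube power4_eq_xxxx algebra_simps)
  have "integral\<^sup>L \<nu> ?P = p * ?P x + q * ?P y"
    using int int1 by (simp add: mom mom1 prob_space pq[symmetric] algebra_simps)
  also have "\<dots> = 0"
    unfolding fun_cong[OF Q, symmetric] by simp
  finally have "integral\<^sup>L \<nu> ?Q = 0" by (simp only: Q)
  moreover have "integrable \<nu> ?Q"
    unfolding Q using int int1 by (intro Bochner_Integration.integrable_add
        Bochner_Integration.integrable_diff integrable_mult_right) auto
  ultimately have "AE z in \<nu>. ?Q z = 0"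
    by (subst integral_nonneg_eq_0_iff_AE[symmetric]) auto
  then have supp: "AE z in \<nu>. z \<in> {x, y}"
    by eventually_elim auto
  show "sets \<nu> = sets (two_point_measure p x q y)"
    by (simp add: sets)
  fix A assume A: "A \<in> sets \<nu>"
  then have A': "A \<in> sets borel" by (simp add: sets)
  \<comment> \<open>The slopes of the linear interpolation of the indicator of \<open>A\<close> at the nodes \<open>x\<close> and \<open>y\<close>.\<close>
  define u v where "u = indicat_real A x / (x - y)" and "v = indicat_real A y / (x - y)"
  have "measure \<nu> A = (\<integral>z. indicator A z \<partial>\<nu>)"
    using A by simp
  also have "\<dots> = (\<integral>z. u * (z - y) + v * (x - z) \<partial>\<nu>)"
  proof (rule integral_cong_AE)
    show "AE z in \<nu>. indicator A z = u * (z - y) + v * (x - z)"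
      using supp by eventually_elim (use \<open>x \<noteq> y\<close> in \<open>auto simp: u_def v_def\<close>)
  qed (use A' in \<open>auto simp: measurable_cong_sets[OF sets refl]\<close>)
  also have "\<dots> = u * (p * x + q * y - y) + v * (x - (p * x + q * y))"
    using int1 by (simp add: mom1 prob_space)
  also have "\<dots> = u * (p * (x - y)) + v * (q * (x - y))"
  proof -
    have q: "q = 1 - p" using pq by simp
    show ?thesis unfolding q by (simp add: algebra_simps)
  qed
  also have "\<dots> = p * indicator A x + q * indicator A y"
    using \<open>x \<noteq> y\<close> by (simp add: u_def v_def)
  finally have "emeasure \<nu> A = ennreal (p * indicator A x + q * indicator A y)"
    by (simp add: emeasure_eq_measure)
  also have "\<dots> = emeasure (two_point_measure p x q y) A"
    using A' \<open>p \<ge> 0\<close> \<open>q \<ge> 0\<close> by (auto simp: emeasure_two_point_measure indicator_def)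
  finally show "emeasure \<nu> A = emeasure (two_point_measure p x q y) A" .
qed

section \<open>Complex Hilbert spaces and bounded operators on a subspace\<close>

lemma cinner_add_right:
  "cinner x (y + z) = cinner x y + cinner x (z :: 'a::complex_hilbert_space)"
  by (metis cinner_add_left cinner_commute complex_cnj_add)

lemma cinner_scaleC_right:
  "cinner x (c *\<^sub>C y) = cnj c * cinner x (y :: 'a::complex_hilbert_space)"
  by (metis cinner_commute cinner_scaleC_left complex_cnj_mult)

lemma norm_scaleC: "norm (c *\<^sub>C x) = cmod c * norm (x :: 'a::complex_hilbert_space)"
proof -
  have "complex_of_real ((norm (c *\<^sub>C x))\<^sup>2) = complex_of_real ((cmod c * norm x)\<^sup>2)"
    unfolding cinner_self[symmetric] cinner_scaleC_left cinner_scaleC_right power_mult_distrib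
      of_real_mult complex_norm_square
    by (simp add: mult.assoc)
  then show ?thesis
    by (metis mult_nonneg_nonneg norm_ge_zero of_real_eq_iff power2_eq_imp_eq)
qed

lemma continuous_scaleC:
  "continuous_on UNIV (\<lambda>x :: 'a::complex_hilbert_space. c *\<^sub>C x)"
proof -
  have "bounded_linear (\<lambda>x :: 'a. c *\<^sub>C x)"
  proof
    show "c *\<^sub>C (r *\<^sub>R x) = r *\<^sub>R (c *\<^sub>C x)" for r and x :: 'a
      by (simp add: scaleR_scaleC scaleC_scaleC mult.commute)
    show "\<exists>K. \<forall>x :: 'a. norm (c *\<^sub>C x) \<le> norm x * K"
      by (rule exI[of _ "cmod c"]) (simp add: norm_scaleC mult.commute)
  qed (simp add: scaleC_add_right)
  then show ?thesis
    by (rule linear_continuous_on)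
qed

lemma subspace_closed_cspan: "complex_vs.subspace (closed_cspan S)"
proof (rule complex_vs.subspaceI)
  show "0 \<in> closed_cspan S"
    unfolding closed_cspan_def using closure_subset complex_vs.span_zero by blast
  fix x assume "x \<in> closed_cspan S"
  then obtain f where f: "\<And>n. f n \<in> complex_vs.span S" "f \<longlonglongrightarrow> x"
    unfolding closed_cspan_def closure_sequential by blast
  show "c *\<^sub>C x \<in> closed_cspan S" for c
    unfolding closed_cspan_def closure_sequential
  proof (intro exI conjI allI)
    show "c *\<^sub>C f n \<in> complex_vs.span S" for n
      using f complex_vs.span_scale by blast
    show "(\<lambda>n. c *\<^sub>C f n) \<longlonglongrightarrow> c *\<^sub>C x"
      using continuous_on_tendsto_compose[OF continuous_scaleC f(2)] by simp
  qed
  fix y assume "y \<in> closed_cspan S"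
  then obtain g where g: "\<And>n. g n \<in> complex_vs.span S" "g \<longlonglongrightarrow> y"
    unfolding closed_cspan_def closure_sequential by blast
  show "x + y \<in> closed_cspan S"
    unfolding closed_cspan_def closure_sequential
  proof (intro exI conjI allI)
    show "f n + g n \<in> complex_vs.span S" for n
      using f g complex_vs.span_add by blast
    show "(\<lambda>n. f n + g n) \<longlonglongrightarrow> x + y"
      using f g by (intro tendsto_add)
  qed
qed

lemma bounded_operator_on_add:
  assumes "complex_vs.subspace M" "bounded_operator_on M S" "bounded_operator_on M T"
  shows "bounded_operator_on M (\<lambda>x. S x + T x)"
proof -
  obtain K where K: "\<And>x. x \<in> M \<Longrightarrow> norm (S x) \<le> K * norm x"
    using assms(2) unfolding bounded_operator_on_def by blast
  obtain L where L: "\<And>x. x \<in> M \<Longrightarrow> norm (T x) \<le> L * norm x"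
    using assms(3) unfolding bounded_operator_on_def by blast
  have "norm (S x + T x) \<le> (K + L) * norm x" if "x \<in> M" for x
    using K[OF that] L[OF that] norm_triangle_ineq[of "S x" "T x"] by (simp add: distrib_right)
  then show ?thesis
    using assms unfolding bounded_operator_on_def
    by (auto simp: scaleC_add_right image_subset_iff intro: complex_vs.subspace_add)
qed

lemma bounded_operator_on_scaleC:
  assumes "complex_vs.subspace M" "bounded_operator_on M T"
  shows "bounded_operator_on M (\<lambda>x. c *\<^sub>C T x)"
proof -
  obtain K where K: "\<And>x. x \<in> M \<Longrightarrow> norm (T x) \<le> K * norm x"
    using assms unfolding bounded_operator_on_def by blast
  have "norm (c *\<^sub>C T x) \<le> (cmod c * K) * norm x" if "x \<in> M" for x
    using mult_left_mono[OF K[OF that], of "cmod c"] by (simp add: norm_scaleC mult.assoc)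
  moreover have "c *\<^sub>C d *\<^sub>C x = d *\<^sub>C c *\<^sub>C x" for d and x :: 'a
    by (simp add: scaleC_scaleC mult.commute)
  ultimately show ?thesis
    using assms unfolding bounded_operator_on_def
    by (auto simp: scaleC_add_right image_subset_iff intro: complex_vs.subspace_scale)
qed

lemma bounded_operator_on_comp:
  assumes "bounded_operator_on M S" "bounded_operator_on M T"
  shows "bounded_operator_on M (\<lambda>x. S (T x))"
proof -
  obtain K where K: "\<And>x. x \<in> M \<Longrightarrow> norm (S x) \<le> K * norm x"
    using assms(1) unfolding bounded_operator_on_def by blast
  obtain L where L: "\<And>x. x \<in> M \<Longrightarrow> norm (T x) \<le> L * norm x"
    using assms(2) unfolding bounded_operator_on_def by blast
  \<comment> \<open>On the zero space a bound \<open>K\<close> may be negative, hence the absolute value.\<close>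
  have "norm (S (T x)) \<le> (\<bar>K\<bar> * L) * norm x" if "x \<in> M" for x
  proof -
    have "T x \<in> M" using assms that unfolding bounded_operator_on_def by blast
    then have "norm (S (T x)) \<le> \<bar>K\<bar> * norm (T x)"
      using K by (meson abs_ge_self mult_right_mono norm_ge_zero order_trans)
    also have "\<dots> \<le> \<bar>K\<bar> * (L * norm x)"
      using L[OF that] by (rule mult_left_mono) simp
    finally show ?thesis by (simp add: mult.assoc)
  qed
  then show ?thesis
    using assms unfolding bounded_operator_on_def by (auto simp: image_subset_iff)
qed

lemma adjoint_on_commute: "adjoint_on M S T \<Longrightarrow> adjoint_on M T S"
  unfolding adjoint_on_def by (metis cinner_commute)

text \<open>
  Taking adjoints exchanges \<open>A\<close> with its adjoint \<open>C\<close> and fixes \<open>C A\<close>, and the real factor is its own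
  conjugate.
\<close>

lemma selfadjoint_gaussian_plus_number:
  assumes "bounded_operator_on M A" "bounded_operator_on M C" "adjoint_on M C A"
  shows "adjoint_on M (\<lambda>x. A x + C x + complex_of_real r *\<^sub>C C (A x))
    (\<lambda>x. A x + C x + complex_of_real r *\<^sub>C C (A x))"
proof -
  have "A x \<in> M" if "x \<in> M" for x
    using that assms unfolding bounded_operator_on_def by blast
  then show ?thesis
    using assms(3) adjoint_on_commute[OF assms(3)] unfolding adjoint_on_def
    by (simp add: cinner_add_left cinner_add_right cinner_scaleC_left cinner_scaleC_right)
qed

section \<open>The invariant plane of the vacuum\<close>

text \<open>
  The plane spanned by \<open>\<Omega>\<close> and \<open>v = T \<Omega>\<close> is invariant, with \<open>T v = \<Omega> + \<lambda> v\<close>. The coefficient of \<open>v\<close>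
  at step \<open>n\<close> becomes that of \<open>\<Omega>\<close> at step \<open>n + 1\<close>, so a single sequence describes both; the root
  equations of \<open>x\<close> and \<open>y\<close> are its recurrence.
\<close>

lemma vacuum_plane_power:
  assumes T: "bounded_operator_on M T" and M: "complex_vs.subspace M" "\<Omega> \<in> M" "v \<in> M"
    and T\<Omega>: "T \<Omega> = v" and Tv: "T v = \<Omega> + complex_of_real l *\<^sub>C v"
    and roots: "x\<^sup>2 = l * x + 1" "y\<^sup>2 = l * y + 1"
    and init: "p + q = 1" "p * x + q * y = 0"
  shows "(T ^^ n) \<Omega> = complex_of_real (p * x ^ n + q * y ^ n) *\<^sub>C \<Omega>
    + complex_of_real (p * x ^ Suc n + q * y ^ Suc n) *\<^sub>C v"
proof (induction n)
  case 0
  then show ?case by (simp only: power_0 power_one_right mult_1_right init funpow_0 One_nat_def[symmetric])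
      (simp add: scaleC_one)
next
  case (Suc n)
  let ?m = "\<lambda>n. complex_of_real (p * x ^ n + q * y ^ n)"
  have "x ^ Suc (Suc n) = l * x ^ Suc n + x ^ n" "y ^ Suc (Suc n) = l * y ^ Suc n + y ^ n"
    using arg_cong[OF roots(1), of "\<lambda>t. t * x ^ n"] arg_cong[OF roots(2), of "\<lambda>t. t * y ^ n"]
    by (simp_all add: power2_eq_square algebra_simps)
  then have rec: "?m (Suc (Suc n)) = ?m n + ?m (Suc n) * complex_of_real l"
    by (simp only:) (simp add: algebra_simps)
  have "(T ^^ Suc n) \<Omega> = T (?m n *\<^sub>C \<Omega> + ?m (Suc n) *\<^sub>C v)"
    by (simp only: funpow.simps o_apply Suc)
  also have "\<dots> = ?m n *\<^sub>C T \<Omega> + ?m (Suc n) *\<^sub>C T v"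
    using T M unfolding bounded_operator_on_def by (simp add: complex_vs.subspace_scale)
  also have "\<dots> = ?m (Suc n) *\<^sub>C \<Omega> + ?m (Suc (Suc n)) *\<^sub>C v"
    unfolding rec T\<Omega> Tv scaleC_add_right scaleC_add_left scaleC_scaleC by (simp only: ac_simps)
  finally show ?case .
qed

theorem proposition5p1:
  fixes e :: "nat \<Rightarrow> 'h::complex_hilbert_space"
    and tensor :: "'h list \<Rightarrow> 'f::complex_hilbert_space"
    and a ad :: "nat \<Rightarrow> 'f \<Rightarrow> 'f"
    and lam :: real
  assumes "orthonormal_basis_on {1..} e"
    and "full_fock_space tensor"
    and "monotone_annihilation_creation tensor e a ad"
    and "lam > 0"
  shows "is_vacuum_distribution (monotone_fock_space tensor e) (tensor [])
    (\<lambda>x. a 1 x + ad 1 x + complex_of_real lam *\<^sub>C ad 1 (a 1 x))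
    (two_point_measure
      (1 / 2 - lam / (2 * sqrt (lam\<^sup>2 + 4))) ((lam + sqrt (lam\<^sup>2 + 4)) / 2)
      (1 / 2 + lam / (2 * sqrt (lam\<^sup>2 + 4))) ((lam - sqrt (lam\<^sup>2 + 4)) / 2))"
proof -
  define s where "s = sqrt (lam\<^sup>2 + 4)"
  have s2: "s\<^sup>2 = lam\<^sup>2 + 4" unfolding s_def by simp
  have "sqrt (lam\<^sup>2) < s" unfolding s_def by (intro real_sqrt_less_mono) simp
  then have s: "lam < s" "s > 0" using \<open>lam > 0\<close> by auto
  define p x q y where "p = 1 / 2 - lam / (2 * s)" and "x = (lam + s) / 2"
    and "q = 1 / 2 + lam / (2 * s)" and "y = (lam - s) / 2"
  have pq: "p \<ge> 0" "q \<ge> 0" "p + q = 1" and xy: "x \<noteq> y"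
    using s \<open>lam > 0\<close> by (auto simp: p_def q_def x_def y_def field_simps)
  \<comment> \<open>The first vacuum moment \<open>\<langle>T \<Omega>, \<Omega>\<rangle> = \<langle>e\<^sub>1, \<Omega>\<rangle>\<close> is 0; this and \<open>p + q = 1\<close> fix the weights.\<close>
  have mean: "p * x + q * y = 0"
    using s by (simp add: p_def q_def x_def y_def field_simps)
  have roots: "x\<^sup>2 = lam * x + 1" "y\<^sup>2 = lam * y + 1"
    using s2 by (simp_all add: x_def y_def power2_eq_square field_simps)

  let ?M = "monotone_fock_space tensor e"
  let ?T = "\<lambda>x. a 1 x + ad 1 x + complex_of_real lam *\<^sub>C ad 1 (a 1 x)"
  have sub: "complex_vs.subspace ?M"
    unfolding monotone_fock_space_def by (rule subspace_closed_cspan)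
  have bd: "bounded_operator_on ?M (a 1)" "bounded_operator_on ?M (ad 1)"
    and adj: "adjoint_on ?M (ad 1) (a 1)"
    and vac: "ad 1 (tensor []) = tensor [e 1]" "a 1 (tensor []) = 0"
    and word: "\<And>w. w \<noteq> [] \<Longrightarrow> decreasing_word w \<Longrightarrow>
      ad 1 (basis_tensor tensor e w) = (if 1 > hd w then basis_tensor tensor e (1 # w) else 0) \<and>
      a 1 (basis_tensor tensor e w) = (if 1 = hd w then basis_tensor tensor e (tl w) else 0)"
    using assms(3) unfolding monotone_annihilation_creation_def by auto
  have e1: "ad 1 (tensor [e 1]) = 0" "a 1 (tensor [e 1]) = tensor []"
    using word[of "[1]"] by (auto simp: decreasing_word_def basis_tensor_def)
  have ad0: "ad 1 0 = 0"
    using bd(2) complex_vs.subspace_0[OF sub] unfolding bounded_operator_on_def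
    by (metis complex_vs.scale_zero_left)
  have T: "bounded_operator_on ?M ?T"
    by (rule bounded_operator_on_add[OF sub bounded_operator_on_add[OF sub bd]
          bounded_operator_on_scaleC[OF sub bounded_operator_on_comp[OF bd(2) bd(1)]]])
  have mem: "tensor [] \<in> ?M" "tensor [e 1] \<in> ?M"
    unfolding monotone_fock_space_def closed_cspan_def
    by (auto intro!: subsetD[OF closure_subset] complex_vs.span_base)
  have power: "(?T ^^ n) (tensor []) = complex_of_real (p * x ^ n + q * y ^ n) *\<^sub>C tensor []
      + complex_of_real (p * x ^ Suc n + q * y ^ Suc n) *\<^sub>C tensor [e 1]" for n
    by (rule vacuum_plane_power[OF T sub mem _ _ roots pq(3) mean]) (simp_all add: vac e1 ad0 del: One_nat_def)
  have "cinner (tensor []) (tensor []) = 1" "cinner (tensor [e 1]) (tensor []) = 0"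
    using assms(2) unfolding full_fock_space_def by auto
  then have mom: "cinner ((?T ^^ n) (tensor [])) (tensor [])
      = complex_of_real (p * x ^ n + q * y ^ n)" for n
    unfolding power cinner_add_left cinner_scaleC_left by simp

  have int: "has_bochner_integral (two_point_measure p x q y) (\<lambda>z. z ^ n) (p * x ^ n + q * y ^ n)"
    for n
    by (rule has_bochner_integral_two_point_measure) (use pq xy in auto)
  have "has_vacuum_moments (tensor []) ?T (two_point_measure p x q y)"
    unfolding has_vacuum_moments_def mom of_real_eq_iff
    using prob_space_two_point_measure[OF pq] int
    by (auto simp: has_bochner_integral_iff)
  moreover have "\<nu> = two_point_measure p x q y" if "has_vacuum_moments (tensor []) ?T \<nu>" for \<nu>
    using that unfolding has_vacuum_moments_def mom of_real_eq_iff
    by (intro two_point_measure_determined) (use pq xy in auto)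
  ultimately have "is_vacuum_distribution ?M (tensor []) ?T (two_point_measure p x q y)"
    unfolding is_vacuum_distribution_def
    using T selfadjoint_gaussian_plus_number[OF bd adj] by blast
  then show ?thesis
    unfolding p_def q_def x_def y_def s_def .
qed

end
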